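(* Suppose $\Lambda_0=0$ (the queue is initially empty). Let $S(t)=\int_0^t\sigma(\tau)\,d\tau$. Then Vickrey's point queue model in cumulative-flow form, $$\frac{d}{dt}F(t)=\delta(t),\qquad \frac{d}{dt}G(t)=\begin{cases}\min\{\delta(t),\sigma(t)\},&F(t)=G(t),\\ \sigma(t),&F(t)>G(t),\end{cases}$$ is solved by $$F(t)=\int_0^t\delta(\tau)\,d\tau,\qquad G(t)=\min_{0\le\tau\le t}\{F(\tau)-S(\tau)\}+S(t),$$ and Vickrey's point queue model in queue-length form, $$\frac{d}{dt}\lambda(t)=\begin{cases}\delta(t)-\sigma(t),&\lambda(t)>0,\\ \max\{0,\delta(t)-\sigma(t)\},&\lambda(t)=0,\end{cases}$$ is solved by $$\lambda(t)=F(t)-S(t)-\min_{0\le\tau\le t}\{F(\tau)-S(\tau)\}.$$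
   Context: Vickrey's point queue model describes a point queue with infinite storage capacity, origin demand $\delta(t)\ge0$ and (general, time-dependent) destination supply $\sigma(t)\ge0$, both continuous in $t\ge0$. $F(t)$ and $G(t)$ are the cumulative in- and out-flows, with $F(0)=\Lambda_0$ (the initial number of vehicles) and $G(0)=0$; the queue length is $\lambda(t)=F(t)-G(t)$. Right-hand sides are discontinuous in the state and solutions need not be differentiable everywhere; the differential equations are understood in integrated form. *)

theory Defs
  imports "HOL-Analysis.Analysis"
begin

text \<open>The right-hand sides are discontinuous in the state, so \<open>y' = v\<close> on \<open>t \<ge> 0\<close> is understood
  in integrated form; absolute integrability on each \<open>{0..t}\<close> makes it the Lebesgue integral.\<close>

definition solves_integrated :: "(real \<Rightarrow> real) \<Rightarrow> (real \<Rightarrow> real) \<Rightarrow> bool" where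
  "solves_integrated y v \<longleftrightarrow>
     (\<forall>t\<ge>0. v absolutely_integrable_on {0..t} \<and> y t = y 0 + integral {0..t} v)"

definition outflow_rate ::
    "(real \<Rightarrow> real) \<Rightarrow> (real \<Rightarrow> real) \<Rightarrow> (real \<Rightarrow> real) \<Rightarrow> (real \<Rightarrow> real) \<Rightarrow> real \<Rightarrow> real" where
  "outflow_rate \<delta> \<sigma> F G t = (if F t = G t then min (\<delta> t) (\<sigma> t) else \<sigma> t)"

definition queue_rate ::
    "(real \<Rightarrow> real) \<Rightarrow> (real \<Rightarrow> real) \<Rightarrow> (real \<Rightarrow> real) \<Rightarrow> real \<Rightarrow> real" where
  "queue_rate \<delta> \<sigma> q t = (if q t > 0 then \<delta> t - \<sigma> t else max 0 (\<delta> t - \<sigma> t))"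

text \<open>Here \<open>q\<close> is the queue length.  In the model the two cases of each rate exhaust the states, i.e. \<open>G \<le> F\<close> and \<open>0 \<le> q\<close>.
  Since the conditionals above are total, this is an explicit requirement on solutions.\<close>

definition vickrey_cumulative ::
    "real \<Rightarrow> (real \<Rightarrow> real) \<Rightarrow> (real \<Rightarrow> real) \<Rightarrow> (real \<Rightarrow> real) \<Rightarrow> (real \<Rightarrow> real) \<Rightarrow> bool" where
  "vickrey_cumulative \<Lambda>\<^sub>0 \<delta> \<sigma> F G \<longleftrightarrow>
     F 0 = \<Lambda>\<^sub>0 \<and> G 0 = 0 \<and> (\<forall>t\<ge>0. G t \<le> F t) \<and>
     solves_integrated F \<delta> \<and> solves_integrated G (outflow_rate \<delta> \<sigma> F G)"

definition vickrey_queue_length ::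
    "real \<Rightarrow> (real \<Rightarrow> real) \<Rightarrow> (real \<Rightarrow> real) \<Rightarrow> (real \<Rightarrow> real) \<Rightarrow> bool" where
  "vickrey_queue_length \<Lambda>\<^sub>0 \<delta> \<sigma> q \<longleftrightarrow>
     q 0 = \<Lambda>\<^sub>0 \<and> (\<forall>t\<ge>0. 0 \<le> q t) \<and> solves_integrated q (queue_rate \<delta> \<sigma> q)"

text \<open>\<open>LEAST\<close> over the image is the attained minimum, not merely the infimum.\<close>

definition running_min :: "(real \<Rightarrow> real) \<Rightarrow> real \<Rightarrow> real" where
  "running_min X t = (LEAST m. m \<in> X ` {0..t})"

end

theory Submission
  imports Defs
begin

text \<open>With \<open>x = \<delta> - \<sigma>\<close> and \<open>X = F - S\<close>, the queue length \<open>q\<close> is \<open>X\<close> minus its running minimum \<open>M\<close>.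
  It need not be differentiable, but its square is: where \<open>q > 0\<close> the minimum \<open>M\<close> is locally constant,
  and where \<open>q = 0\<close> the Lipschitz bound on \<open>q\<close> makes \<open>q\<^sup>2\<close> quadratically small, so \<open>(q\<^sup>2)' = 2 q x\<close>
  throughout. Integrating the derivative \<open>q x / sqrt (q\<^sup>2 + \<epsilon>\<^sup>2)\<close> of \<open>sqrt (q\<^sup>2 + \<epsilon>\<^sup>2)\<close> and letting \<open>\<epsilon> \<rightarrow> 0\<close>
  by dominated convergence gives \<open>q t = \<integral> x 1\<^bsub>{q > 0}\<^esub>\<close>. At a positive time with \<open>q = 0\<close> the path \<open>X\<close> attains
  its running minimum, hence \<open>x \<le> 0\<close> there and the integrand is the required rate. The equation for
  \<open>G = F - q\<close> follows by subtraction.\<close>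

section \<open>Running minimum of a continuous path\<close>

lemma
  assumes "continuous_on {0..t} X" "0 \<le> t"
  shows running_min_attained: "running_min X t \<in> X ` {0..t}"
    and running_min_le: "\<And>s. s \<in> {0..t} \<Longrightarrow> running_min X t \<le> X s"
proof -
  obtain u where u: "u \<in> {0..t}" "\<And>s. s \<in> {0..t} \<Longrightarrow> X u \<le> X s"
    using continuous_attains_inf[of "{0..t}" X] assms by auto
  have "running_min X t = X u"
    unfolding running_min_def using u by (intro Least_equality) auto
  then show "running_min X t \<in> X ` {0..t}" "\<And>s. s \<in> {0..t} \<Longrightarrow> running_min X t \<le> X s"
    using u by auto
qed

lemma running_min_0 [simp]: "running_min X 0 = X 0"
  unfolding running_min_def by (auto intro: Least_equality)

lemma running_min_antimono:
  assumes "continuous_on {0..t} X" "0 \<le> s" "s \<le> t"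
  shows "running_min X t \<le> running_min X s"
proof -
  have "continuous_on {0..s} X"
    using assms(1) by (rule continuous_on_subset) (use assms in auto)
  then obtain u where "u \<in> {0..s}" "running_min X s = X u"
    using running_min_attained[of s X] assms by auto
  then show ?thesis
    using running_min_le[of t X u] assms by auto
qed

text \<open>A minimiser over \<open>{0..t}\<close> cannot lie in \<open>{s..t}\<close>, so it
  already competes in the minimum over \<open>{0..s}\<close>.\<close>

lemma running_min_eq_if_greater_between:
  assumes cont: "continuous_on {0..t} X" and st: "0 \<le> s" "s \<le> t"
    and gt: "\<And>u. u \<in> {s..t} \<Longrightarrow> running_min X t < X u"
  shows "running_min X s = running_min X t"
proof -
  obtain u where u: "u \<in> {0..t}" "running_min X t = X u"
    using running_min_attained[of t X] assms by auto
  have "u \<in> {0..s}"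
    using gt[of u] u by force
  moreover have "continuous_on {0..s} X"
    using cont by (rule continuous_on_subset) (use assms in auto)
  ultimately have "running_min X s \<le> running_min X t"
    using running_min_le[of s X u] u st by auto
  with running_min_antimono[OF cont st] show ?thesis by simp
qed

text \<open>Take a minimiser \<open>u\<close> over \<open>{0..t}\<close> for
  \<open>s \<le> t\<close>. If \<open>u \<le> s\<close>, the minimum has not changed since
  \<open>s\<close>; otherwise \<open>X\<close> falls by at most \<open>C * (t - s)\<close> on the
  way from \<open>s\<close> to \<open>u\<close>.\<close>

lemma running_min_lipschitz:
  assumes lip: "C-lipschitz_on {0..T} X"
  shows "C-lipschitz_on {0..T} (running_min X)"
proof (rule lipschitz_onI)
  show C: "0 \<le> C" using lip by (rule lipschitz_on_nonneg)
  have ordered: "dist (running_min X s) (running_min X t) \<le> C * dist s t"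
    if st: "0 \<le> s" "s \<le> t" "t \<le> T" for s t
  proof -
    have cont: "continuous_on {0..r} X" if "r \<le> T" for r
      using lipschitz_on_continuous_on[OF lip] by (rule continuous_on_subset) (use that in auto)
    obtain u where u: "u \<in> {0..t}" "running_min X t = X u"
      using running_min_attained[OF cont, of t] st by auto
    have "running_min X s \<le> X u + C * (t - s)"
    proof (cases "u \<le> s")
      case True
      then have "running_min X s \<le> X u"
        using running_min_le[OF cont, of s u] u st by auto
      then show ?thesis using C st by (smt (verit) mult_nonneg_nonneg)
    next
      case False
      have "\<bar>X s - X u\<bar> \<le> C * \<bar>s - u\<bar>"
        using lipschitz_onD[OF lip, of s u] u st by (auto simp: dist_real_def)
      moreover have "C * \<bar>s - u\<bar> \<le> C * (t - s)"
        using C u False by (intro mult_left_mono) auto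
      moreover have "running_min X s \<le> X s"
        using running_min_le[OF cont, of s s] st by auto
      ultimately show ?thesis by linarith
    qed
    moreover have "running_min X t \<le> running_min X s"
      using running_min_antimono[OF cont] st by auto
    ultimately show ?thesis
      using u st by (auto simp: dist_real_def)
  qed
  show "dist (running_min X s) (running_min X t) \<le> C * dist s t"
    if "s \<in> {0..T}" "t \<in> {0..T}" for s t
    using ordered[of s t] ordered[of t s] that by (cases "s \<le> t") (auto simp: dist_commute)
qed

section \<open>Reflection of a path at its running minimum (Skorokhod map)\<close>

definition reflected :: "(real \<Rightarrow> real) \<Rightarrow> real \<Rightarrow> real" where
  "reflected X t = X t - running_min X t"

lemma reflected_nonneg:
  assumes "continuous_on {0..t} X" "0 \<le> t"
  shows "0 \<le> reflected X t"
  using running_min_le[of t X t] assms by (auto simp: reflected_def)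

text \<open>Serves the times when the queue is empty, where \<open>f\<close> itself may have a kink:
  the difference quotient of the square is at most
  \<open>C\<^sup>2 * \<bar>s - t\<bar>\<close>.\<close>

lemma has_real_derivative_power2_lipschitz_zero:
  fixes f :: "real \<Rightarrow> real"
  assumes lip: "C-lipschitz_on A f" and t: "t \<in> A" "f t = 0"
  shows "((\<lambda>s. (f s)\<^sup>2) has_real_derivative 0) (at t within A)"
  unfolding has_field_derivative_iff
proof (rule Lim_null_comparison)
  show "\<forall>\<^sub>F s in at t within A. norm (((f s)\<^sup>2 - (f t)\<^sup>2) / (s - t)) \<le> C\<^sup>2 * \<bar>s - t\<bar>"
    unfolding eventually_at_topological
  proof (intro exI[of _ UNIV] conjI ballI impI)
    fix s assume s: "s \<noteq> t" "s \<in> A"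
    have "\<bar>f s\<bar> \<le> C * \<bar>s - t\<bar>"
      using lipschitz_onD[OF lip, of s t] s t by (auto simp: dist_real_def)
    then have "\<bar>f s\<bar>\<^sup>2 \<le> (C * \<bar>s - t\<bar>)\<^sup>2"
      by (intro power_mono) auto
    then show "norm (((f s)\<^sup>2 - (f t)\<^sup>2) / (s - t)) \<le> C\<^sup>2 * \<bar>s - t\<bar>"
      using s t by (simp add: divide_simps power2_eq_square algebra_simps)
  qed auto
  show "((\<lambda>s. C\<^sup>2 * \<bar>s - t\<bar>) \<longlongrightarrow> 0) (at t within A)"
    by (auto intro!: tendsto_eq_intros)
qed

text \<open>By continuity \<open>X\<close> stays above \<open>running_min X t\<close> near
  \<open>t\<close>, so no new minimum is set there and the reflected path differs from
  \<open>X\<close> by a constant.\<close>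

lemma reflected_pos_has_derivative:
  assumes deriv: "(X has_real_derivative d) (at t within {0..T})"
    and cont: "continuous_on {0..T} X" and t: "t \<in> {0..T}" and pos: "reflected X t > 0"
  shows "(reflected X has_real_derivative d) (at t within {0..T})"
proof -
  obtain e where e: "e > 0" "\<And>u. u \<in> {0..T} \<Longrightarrow> dist u t < e \<Longrightarrow> dist (X u) (X t) < reflected X t"
    using cont t pos unfolding continuous_on_iff by meson
  have gt: "running_min X t < X u" if "u \<in> {0..T}" "dist u t < e" for u
    using e(2)[OF that] by (auto simp: reflected_def dist_real_def)
  have cont': "continuous_on {0..r} X" if "r \<le> T" for r
    using cont by (rule continuous_on_subset) (use that in auto)
  have const: "running_min X s = running_min X t" if s: "s \<in> {0..T}" "dist s t < e" for s
  proof (cases "s \<le> t")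
    case True
    show ?thesis
      using s t True by (intro running_min_eq_if_greater_between cont' gt) (auto simp: dist_real_def)
  next
    case False
    \<comment> \<open>To the right of \<open>t\<close> the strict bound is needed against the later
      minimum \<open>running_min X s\<close>; monotonicity puts that below
      \<open>running_min X t\<close>.\<close>
    have "running_min X s \<le> running_min X t"
      using running_min_antimono[OF cont', of s t] False s t by auto
    then have "running_min X t = running_min X s"
      using s t False
      by (intro running_min_eq_if_greater_between cont' le_less_trans[OF _ gt])
        (auto simp: dist_real_def)
    then show ?thesis by simp
  qed
  have "((\<lambda>s. X s - running_min X t) has_real_derivative d) (at t within {0..T})"
    by (auto intro!: derivative_eq_intros deriv)
  then show ?thesis
    by (rule has_field_derivative_transform_within[OF _ e(1) t]) (simp add: const reflected_def)
qed

lemma lipschitz_if_C1: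
  fixes X x :: "real \<Rightarrow> real"
  assumes cont: "continuous_on {0..T} x"
    and deriv: "\<And>t. t \<in> {0..T} \<Longrightarrow> (X has_real_derivative x t) (at t within {0..T})"
  obtains C where "C-lipschitz_on {0..T} X"
proof -
  have "bounded (x ` {0..T})"
    by (intro compact_imp_bounded compact_continuous_image cont) auto
  then obtain C where C: "C > 0" "\<And>t. t \<in> {0..T} \<Longrightarrow> norm (x t) \<le> C"
    unfolding bounded_pos by auto
  have "norm (X s - X t) \<le> C * norm (s - t)" if "s \<in> {0..T}" "t \<in> {0..T}" for s t
    by (rule field_differentiable_bound[OF _ deriv C(2)]) (use that in auto)
  then have "C-lipschitz_on {0..T} X"
    using C(1) by (intro lipschitz_onI) (auto simp: dist_norm)
  then show ?thesis by (rule that)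
qed

lemma reflected_lipschitz:
  assumes "C-lipschitz_on {0..T} X"
  shows "(C + C)-lipschitz_on {0..T} (reflected X)"
  using lipschitz_on_diff[OF assms running_min_lipschitz[OF assms]]
  by (simp add: reflected_def[abs_def])

lemma reflected_power2_has_derivative:
  assumes lip: "C-lipschitz_on {0..T} X"
    and deriv: "(X has_real_derivative d) (at t within {0..T})"
    and t: "t \<in> {0..T}"
  shows "((\<lambda>s. (reflected X s)\<^sup>2) has_real_derivative 2 * reflected X t * d) (at t within {0..T})"
proof (cases "reflected X t = 0")
  case True
  then show ?thesis
    using has_real_derivative_power2_lipschitz_zero[OF reflected_lipschitz[OF lip] t True] by simp
next
  case False
  have cont: "continuous_on {0..T} X"
    using lip by (rule lipschitz_on_continuous_on)
  have "continuous_on {0..t} X"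
    using cont by (rule continuous_on_subset) (use t in auto)
  then have "reflected X t > 0"
    using False reflected_nonneg[of t X] t by auto
  from reflected_pos_has_derivative[OF deriv cont t this] show ?thesis
    by (auto intro!: derivative_eq_intros)
qed

section \<open>Integral equation for the reflected path\<close>

lemma reflected_has_integral:
  assumes cont: "continuous_on {0..T} x" and T: "0 \<le> T"
    and deriv: "\<And>t. t \<in> {0..T} \<Longrightarrow> (X has_real_derivative x t) (at t within {0..T})"
  shows "((\<lambda>t. if reflected X t > 0 then x t else 0) has_integral reflected X T) {0..T}"
proof -
  define Q where "Q = reflected X"
  define \<epsilon> :: "nat \<Rightarrow> real" where "\<epsilon> k = inverse (real (Suc k))" for k
  define R where "R k t = sqrt ((Q t)\<^sup>2 + (\<epsilon> k)\<^sup>2)" for k t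
  obtain C where C: "C-lipschitz_on {0..T} X"
    using lipschitz_if_C1[OF cont deriv] by blast
  have contX: "continuous_on {0..t} X" if "t \<in> {0..T}" for t
    using lipschitz_on_continuous_on[OF C] by (rule continuous_on_subset) (use that in auto)
  have Q_nonneg: "0 \<le> Q t" if "t \<in> {0..T}" for t
    using reflected_nonneg[OF contX[OF that]] that by (auto simp: Q_def)
  have \<epsilon>_pos: "\<epsilon> k > 0" for k
    by (simp add: \<epsilon>_def)
  have \<epsilon>_lim: "\<epsilon> \<longlonglongrightarrow> 0"
    unfolding \<epsilon>_def by (rule LIMSEQ_inverse_real_of_nat)
  \<comment> \<open>The shift keeps the argument of the square root away from 0, where the root is
    not differentiable.\<close>
  have sum_pos: "(Q t)\<^sup>2 + (\<epsilon> k)\<^sup>2 > 0" for k t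
    using \<epsilon>_pos[of k] by (simp add: add_nonneg_pos)
  have R_pos: "R k t > 0" for k t
    using sum_pos by (simp add: R_def)
  \<comment> \<open>The factor \<open>Q t / R k t\<close> is thus at most 1 in absolute value, which
    makes \<open>\<bar>x t\<bar>\<close> a dominating function for all \<open>k\<close>.\<close>
  have Q_le_R: "\<bar>Q t\<bar> \<le> R k t" for k t
    unfolding R_def by (rule real_le_rsqrt) simp
  have "(R k has_real_derivative Q t * x t / R k t) (at t within {0..T})" if t: "t \<in> {0..T}" for k t
  proof -
    have "((\<lambda>t. (Q t)\<^sup>2 + (\<epsilon> k)\<^sup>2) has_real_derivative 2 * Q t * x t) (at t within {0..T})"
      using DERIV_add[OF reflected_power2_has_derivative[OF C deriv[OF t] t] DERIV_const]
      by (simp add: Q_def)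
    from DERIV_chain2[OF DERIV_real_sqrt[OF sum_pos] this] show ?thesis
      unfolding R_def by (rule DERIV_cong) (simp add: field_simps)
  qed
  then have I: "((\<lambda>t. Q t * x t / R k t) has_integral R k T - R k 0) {0..T}" for k
    using T by (intro fundamental_theorem_of_calculus)
      (auto simp: has_real_derivative_iff_has_vector_derivative)
  have R_lim: "(\<lambda>k. R k t) \<longlonglongrightarrow> Q t" if "t \<in> {0..T}" for t
    using Q_nonneg[OF that] unfolding R_def by (auto intro!: tendsto_eq_intros \<epsilon>_lim)
  show ?thesis
  proof (rule has_integral_dominated_convergence[OF I])
    show "(\<lambda>t. \<bar>x t\<bar>) integrable_on {0..T}"
      by (intro integrable_continuous_real continuous_intros cont)
    show "\<forall>t\<in>{0..T}. norm (Q t * x t / R k t) \<le> \<bar>x t\<bar>" for k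
    proof
      fix t
      have "\<bar>Q t\<bar> * \<bar>x t\<bar> \<le> R k t * \<bar>x t\<bar>"
        by (intro mult_right_mono Q_le_R) simp
      then show "norm (Q t * x t / R k t) \<le> \<bar>x t\<bar>"
        using R_pos[of k t] by (simp add: abs_mult pos_divide_le_eq mult.commute)
    qed
    show "\<forall>t\<in>{0..T}. (\<lambda>k. Q t * x t / R k t) \<longlonglongrightarrow> (if reflected X t > 0 then x t else 0)"
    proof
      fix t assume t: "t \<in> {0..T}"
      show "(\<lambda>k. Q t * x t / R k t) \<longlonglongrightarrow> (if reflected X t > 0 then x t else 0)"
      \<comment> \<open>On the zero set the integrand vanishes for every \<open>k\<close>; elsewhere
        \<open>Q t / R k t\<close> tends to 1.\<close>
      proof (cases "Q t = 0")
        case False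
        then have "(\<lambda>k. Q t * x t / R k t) \<longlonglongrightarrow> x t"
          by (auto intro!: tendsto_eq_intros R_lim t)
        then show ?thesis using False Q_nonneg[OF t] by (simp add: Q_def)
      qed (simp add: Q_def)
    qed
    \<comment> \<open>The boundary term \<open>R k 0\<close> therefore equals
      \<open>\<epsilon> k\<close> and disappears in the limit.\<close>
    have "Q 0 = 0" by (simp add: Q_def reflected_def)
    then show "(\<lambda>k. R k T - R k 0) \<longlonglongrightarrow> reflected X T"
      using R_lim[of T] R_lim[of 0] T by (auto intro!: tendsto_eq_intros simp: Q_def)
  qed
qed

text \<open>With a positive derivative, \<open>X\<close> would be smaller just before
  \<open>t\<close>, although \<open>X t\<close> is the minimum over \<open>{0..t}\<close>.
  Positivity of \<open>t\<close> leaves room on the left.\<close>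

lemma derivative_nonpos_if_reflected_zero:
  assumes deriv: "(X has_real_derivative d) (at t within {0..T})"
    and cont: "continuous_on {0..t} X" and t: "0 < t" "t \<le> T" and zero: "reflected X t = 0"
  shows "d \<le> 0"
proof (rule ccontr)
  assume "\<not> d \<le> 0"
  then obtain e where e: "e > 0" "\<And>h. h > 0 \<Longrightarrow> t - h \<in> {0..T} \<Longrightarrow> h < e \<Longrightarrow> X (t - h) < X t"
    using has_real_derivative_pos_inc_left[OF deriv] by auto
  \<comment> \<open>Half of \<open>e\<close> stays strictly within the radius, and the cap
    \<open>t\<close> keeps \<open>t - h\<close> nonnegative.\<close>
  define h where "h = min (e / 2) t"
  have h: "h > 0" "h < e" "h \<le> t"
    using e t by (auto simp: h_def)
  then have "X (t - h) < X t"
    using e(2) t by auto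
  moreover have "running_min X t \<le> X (t - h)"
    using running_min_le[OF cont, of "t - h"] h t by auto
  ultimately show False
    using zero by (simp add: reflected_def)
qed

lemma queue_rate_reflected:
  fixes X q \<delta> \<sigma> :: "real \<Rightarrow> real"
  assumes cont: "continuous_on {0..T} (\<lambda>t. \<delta> t - \<sigma> t)" and T: "0 \<le> T"
    and deriv: "\<And>t. t \<in> {0..T} \<Longrightarrow> (X has_real_derivative \<delta> t - \<sigma> t) (at t within {0..T})"
    and q: "\<And>t. t \<in> {0..T} \<Longrightarrow> q t = reflected X t"
  shows "queue_rate \<delta> \<sigma> q absolutely_integrable_on {0..T}"
    and "(queue_rate \<delta> \<sigma> q has_integral reflected X T) {0..T}"
proof -
  have contX: "continuous_on {0..t} X" if "t \<le> T" for t
    using DERIV_continuous_on[OF deriv] by (rule continuous_on_subset) (use that in auto)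
  \<comment> \<open>Time 0 is left out: the reflected path vanishes there whatever the sign of
    \<open>\<delta> 0 - \<sigma> 0\<close>, so the rate may be positive. One point does not affect
    the integral.\<close>
  have rate: "queue_rate \<delta> \<sigma> q t = (if reflected X t > 0 then \<delta> t - \<sigma> t else 0)"
    if t: "t \<in> {0..T} - {0}" for t
  proof (cases "reflected X t > 0")
    case False
    then have "reflected X t = 0"
      using reflected_nonneg[OF contX, of t] t by auto
    then have "\<delta> t - \<sigma> t \<le> 0"
      using derivative_nonpos_if_reflected_zero[OF deriv contX, of t] t by auto
    then show ?thesis using False t q[of t] by (auto simp: queue_rate_def)
  qed (use t q[of t] in \<open>auto simp: queue_rate_def\<close>)
  show I: "(queue_rate \<delta> \<sigma> q has_integral reflected X T) {0..T}"
    by (rule has_integral_spike_finite[where S = "{0}", OF _ rate reflected_has_integral[OF cont T deriv]])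
      simp_all
  show "queue_rate \<delta> \<sigma> q absolutely_integrable_on {0..T}"
  \<comment> \<open>\<open>I\<close> gives only gauge integrability; a continuous bound on both
    branches of the rate upgrades it.\<close>
  proof (rule absolutely_integrable_integrable_bound)
    show "norm (queue_rate \<delta> \<sigma> q t) \<le> \<bar>\<delta> t - \<sigma> t\<bar>" for t
      by (auto simp: queue_rate_def)
    show "(\<lambda>t. \<bar>\<delta> t - \<sigma> t\<bar>) integrable_on {0..T}"
      by (intro integrable_continuous_real continuous_intros cont)
  qed (use I in \<open>blast intro: has_integral_integrable\<close>)
qed

section \<open>The two forms of the point queue model\<close>

theorem theorem5p1:
  fixes \<delta> \<sigma> F G S q :: "real \<Rightarrow> real" and \<Lambda>\<^sub>0 :: real
  assumes "continuous_on {0..} \<delta>" and "continuous_on {0..} \<sigma>"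
    and "\<And>t. t \<ge> 0 \<Longrightarrow> \<delta> t \<ge> 0" and "\<And>t. t \<ge> 0 \<Longrightarrow> \<sigma> t \<ge> 0"
    and "\<Lambda>\<^sub>0 = 0"
    and S: "\<And>t. t \<ge> 0 \<Longrightarrow> S t = integral {0..t} \<sigma>"
    and F: "\<And>t. t \<ge> 0 \<Longrightarrow> F t = integral {0..t} \<delta>"
    and G: "\<And>t. t \<ge> 0 \<Longrightarrow> G t = running_min (\<lambda>\<tau>. F \<tau> - S \<tau>) t + S t"
    and q: "\<And>t. t \<ge> 0 \<Longrightarrow> q t = F t - S t - running_min (\<lambda>\<tau>. F \<tau> - S \<tau>) t"
  shows "vickrey_cumulative \<Lambda>\<^sub>0 \<delta> \<sigma> F G \<and> vickrey_queue_length \<Lambda>\<^sub>0 \<delta> \<sigma> q"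
proof -
  define X where "X = (\<lambda>\<tau>. F \<tau> - S \<tau>)"
  have cont: "continuous_on {0..T} \<delta>" "continuous_on {0..T} \<sigma>" for T
    using assms(1,2) by (auto elim!: continuous_on_subset)
  have deriv: "(X has_real_derivative \<delta> t - \<sigma> t) (at t within {0..T})" if t: "t \<in> {0..T}" for t T
  proof -
    have "((\<lambda>u. integral {0..u} \<delta> - integral {0..u} \<sigma>) has_real_derivative \<delta> t - \<sigma> t)
        (at t within {0..T})"
      by (intro DERIV_diff integral_has_real_derivative cont t)
    \<comment> \<open>\<open>F\<close> and \<open>S\<close> are known to be these integrals only at
      nonnegative times. The agreement covers all of \<open>{0..T}\<close>, so the radius 1 is
      arbitrary.\<close>
    then show ?thesis
      by (rule has_field_derivative_transform_within[OF _ zero_less_one t]) (auto simp: X_def F S)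
  qed
  have q_reflected: "q t = reflected X t" if "t \<ge> 0" for t
    using q[OF that] by (simp add: X_def reflected_def)
  have q_nonneg: "0 \<le> q t" if "t \<ge> 0" for t
    using reflected_nonneg[OF DERIV_continuous_on[OF deriv]] that by (simp add: q_reflected)
  have G_eq: "G t = F t - q t" if "t \<ge> 0" for t
    using G[OF that] q[OF that] by simp
  have zero: "F 0 = 0" "q 0 = 0" "G 0 = 0"
    using F[of 0] S[of 0] q[of 0] G[of 0] by auto
  have q_rate: "queue_rate \<delta> \<sigma> q absolutely_integrable_on {0..t}"
    "(queue_rate \<delta> \<sigma> q has_integral q t) {0..t}" if "t \<ge> 0" for t
    using queue_rate_reflected[OF _ that deriv, of q] q_reflected cont that
    by (auto intro!: continuous_intros)
  have \<delta>_int: "\<delta> absolutely_integrable_on {0..t}" for t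
    by (intro absolutely_integrable_continuous_real cont)
  have \<delta>_has_int: "(\<delta> has_integral F t) {0..t}" if "t \<ge> 0" for t
    using F[OF that] integrable_continuous_real[OF cont(1)] by (simp add: has_integral_integral)
  \<comment> \<open>\<open>F t = G t\<close> means \<open>q t = 0\<close>, and
    \<open>min a b = a - max 0 (a - b)\<close> matches the rates in that case.\<close>
  have out: "outflow_rate \<delta> \<sigma> F G t = \<delta> t - queue_rate \<delta> \<sigma> q t" if "t \<ge> 0" for t
    using q_nonneg[OF that] G_eq[OF that] by (auto simp: outflow_rate_def queue_rate_def)
  have "solves_integrated q (queue_rate \<delta> \<sigma> q)"
    using q_rate zero by (simp add: solves_integrated_def integral_unique[OF q_rate(2)])
  moreover have "solves_integrated F \<delta>"
    using \<delta>_int F zero by (simp add: solves_integrated_def)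
  moreover have "solves_integrated G (outflow_rate \<delta> \<sigma> F G)"
    unfolding solves_integrated_def
  proof (intro allI impI conjI)
    fix t :: real assume t: "t \<ge> 0"
    have "(\<lambda>t. \<delta> t - queue_rate \<delta> \<sigma> q t) absolutely_integrable_on {0..t}"
      using \<delta>_int q_rate(1)[OF t] by (rule set_integral_diff(1))
    then show "outflow_rate \<delta> \<sigma> F G absolutely_integrable_on {0..t}"
      by (rule absolutely_integrable_spike[OF _ negligible_empty]) (simp add: out)
    have "((\<lambda>t. \<delta> t - queue_rate \<delta> \<sigma> q t) has_integral F t - q t) {0..t}"
      using \<delta>_has_int[OF t] q_rate(2)[OF t] by (rule has_integral_diff)
    then have "(outflow_rate \<delta> \<sigma> F G has_integral F t - q t) {0..t}"
      by (rule has_integral_eq[rotated]) (simp add: out)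
    then show "G t = G 0 + integral {0..t} (outflow_rate \<delta> \<sigma> F G)"
      using G_eq[OF t] zero by (simp add: integral_unique)
  qed
  ultimately show ?thesis
    using zero q_nonneg G_eq \<open>\<Lambda>\<^sub>0 = 0\<close>
    by (auto simp: vickrey_cumulative_def vickrey_queue_length_def)
qed

end
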